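(* Let $\Delta_c$ be a concrete higher-order unification context, let $T$ be a concrete term, let $\Delta_1$ be a (flattened) unification context, and let $k\ge0$. Suppose $\mathrm{exp}^{\Delta_c}_k(\lambda\bar x.\,\underline s\,\bar y)=\mathrm{exp}^{\Delta_1}_k(\lambda\bar x.\,\underline s\,\bar y)$ for every recursion constant $\underline s$ occurring in $T$ (and all $\bar x,\bar y$). Then: (1) if $T\rhd^{\mathrm{con}}U\diamond\Delta_2$, then $\mathrm{exp}^{\Delta_c}_k(T)=\mathrm{exp}^{\Delta_1,\Delta_2}_k(U)$; (2) if $T\rhd^{\mathrm{rec}}N\diamond\Delta_2$, then $\mathrm{exp}^{\Delta_c}_k(T)=\mathrm{exp}^{\Delta_1,\Delta_2}_k(N)$.
   Context: All objects are simply typed: constructors $c,d,e$, bound variables $x,y,z$, unification metavariables $H,G,F$, recursion constants $\underline r,\underline s,\underline t$. $\bar x$ denotes a list of pairwise distinct variables; $\lambda\bar x.$ iterated abstraction; $h\,\overline T$ iterated application; $[\bar y/\bar x]$ simultaneous variable renaming; $FV$ free variables. Terms are in $\beta$-normal $\eta$-long form except that arguments of metavariables and recursion constants are bare variables; $\lambda$-bound variables are up to $\alpha$-renaming; $h$ ranges over constructors and variables. Concrete syntax: $T ::= \lambda\bar x.\,h\,\overline T\mid\lambda\bar x.\,H\,\bar y\mid\lambda\bar x.\,\underline r\,\bar y$; a concrete unification context $\Delta_c$ is a finite list of equations $T_1\doteq T_2$ and closed definitions $\underline r=_d\lambda\bar x.\,h\,\overline T$ (with $FV(h\,\overline T)\subseteq\bar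 x$). Flattened syntax: metavariables are tagged contractive $H^{\mathrm{con}}$ or recursive $H^{\mathrm{rec}}$; contractive terms $U ::= \lambda\bar x.\,y\,\overline N\mid\lambda\bar x.\,c\,\overline N\mid\lambda\bar x.\,H^{\mathrm{con}}\,\bar y$; recursive terms $N ::= \lambda\bar x.\,\underline r\,\bar y\mid\lambda\bar x.\,H^{\mathrm{rec}}\,\bar y$. A unification context $\Delta$ is a finite collection of equations $U_1\doteq U_2$, $N_1\doteq N_2$, closed definitions $\underline r=_dU$ ($FV(U)=\emptyset$), and possibly $\mathrm{contra}$. $\Delta_1,\Delta_2$ denotes union after renaming recursion constants of $\Delta_2$ apart. Expansion into $M_\bot ::= \lambda\bar x.\,y\,\overline{M_\bot}\mid\lambda\bar x.\,c\,\overline{M_\bot}\mid\lambda\bar x.\,H^{\mathrm{con}}\,\bar y\mid\lambda\bar x.\,H^{\mathrm{rec}}\,\bar y\mid\bot$: for concrete terms $\mathrm{exp}^{\Delta_c}_0(T)=\bot$; $\mathrm{exp}^{\Delta_c}_{k+1}(\lambda\bar x.\,h\,T_1\cdots T_n)=\lambda\bar x.\,h\,(\mathrm{exp}^{\Delta_c}_k(T_1))\cdots(\mathrm{exp}^{\Delta_c}_k(T_n))$; $\mathrm{exp}^{\Delta_c}_{k+1}(\lambda\bar x.\,H\,\bar y)=\lambda\bar x.\,H^{\mathrm{rec}}\,\bar y$; $\mathrm{exp}^{\Delta_c}_{k+1}(\lambda\bar x.\,\underline r\,\bar y)=\mathrm{exp}^{\Delta_c}_{k+1}(\lambda\bar x.\,[\bar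 y/\bar z](h\,\overline T))$ where $\underline r=_d\lambda\bar z.\,h\,\overline T\in\Delta_c$. For flattened terms the same clauses, with $\mathrm{exp}^\Delta_{k+1}(\lambda\bar x.\,H^m\bar y)=\lambda\bar x.\,H^m\bar y$ and $\mathrm{exp}^\Delta_{k+1}(\lambda\bar x.\,\underline r\,\bar y)=\mathrm{exp}^\Delta_{k+1}(\lambda\bar x.\,[\bar y/\bar z]U)$ where $\underline r=_d\lambda\bar z.\,U\in\Delta$. Translation: $\lambda\bar x.\,H\,\bar y\rhd^{\mathrm{rec}}\lambda\bar x.\,H^{\mathrm{rec}}\,\bar y\diamond[\,]$; $\lambda\bar x.\,\underline r\,\bar y\rhd^{\mathrm{rec}}\lambda\bar x.\,\underline r\,\bar y\diamond[\,]$; if $h\,\overline T\rhd^{\mathrm{con}}U\diamond\Delta$ and $\bar z=FV(h\,\overline T)$ then $\lambda\bar x.\,h\,\overline T\rhd^{\mathrm{rec}}\lambda\bar x.\,\underline r\,\bar z\diamond(\Delta,\underline r=_d\lambda\bar z.\,U)$ with $\underline r$ fresh; if $T_i\rhd^{\mathrm{rec}}N_i\diamond\Delta_i$ for $1\le i\le n$ then $\lambda\bar x.\,h\,T_1\cdots T_n\rhd^{\mathrm{con}}\lambda\bar x.\,h\,N_1\cdots N_n\diamond(\Delta_1,\dots,\Delta_n)$; no $\rhd^{\mathrm{con}}$ rules for metavariable- or recursion-constant-headed terms. Fresh constants do not occur in $\Delta_c$ or $\Delta_1$. *)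

theory Defs
  imports Main
begin

datatype 'b ty = Base 'b | Fun "'b ty" "'b ty"

definition arrs :: "'b ty list \<Rightarrow> 'b ty \<Rightarrow> 'b ty" where
  "arrs As B = foldr Fun As B"

text \<open>Constructors, metavariables and recursion constants carry their types (Church style).\<close>

record ('b, 'c, 'm, 'r) signature =
  con_ty :: "'c \<Rightarrow> 'b ty"
  meta_ty :: "'m \<Rightarrow> 'b ty"
  rec_ty :: "'r \<Rightarrow> 'b ty"

text \<open>
  Terms up to \<open>\<alpha>\<close>-renaming are represented by de Bruijn indices with block binders. A term
  constructor whose first argument is the list \<open>[A\<^sub>0, \<dots>, A\<^bsub>n-1\<^esub>]\<close> stands for the iterated
  abstraction \<open>\<lambda>x\<^sub>0 \<dots> x\<^bsub>n-1\<^esub>.\<close> over \<open>n\<close> variables of these types. In its body the index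
  \<open>i < n\<close> denotes \<open>x\<^sub>i\<close>, counted from the \<^emph>\<open>left\<close>, and an index \<open>i \<ge> n\<close> denotes the
  variable with index \<open>i - n\<close> outside. Hence, if the term lives in the typing context \<open>G\<close>,
  its body lives in \<open>As @ G\<close>, where variable \<open>i\<close> has type \<open>(As @ G) ! i\<close>.
\<close>

datatype 'c head = Con 'c | Var nat

datatype ('b, 'c, 'm, 'r) conc =
    CApp "'b ty list" "'c head" "('b, 'c, 'm, 'r) conc list"
  | CMeta "'b ty list" 'm "nat list"
  | CRec "'b ty list" 'r "nat list"

text \<open>\<open>CDef r zs h Ts\<close> is the definition \<open>r =\<^sub>d \<lambda>zs. h Ts\<close>.\<close>

datatype ('b, 'c, 'm, 'r) citem =
    CEq "('b, 'c, 'm, 'r) conc" "('b, 'c, 'm, 'r) conc"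
  | CDef 'r "'b ty list" "'c head" "('b, 'c, 'm, 'r) conc list"

type_synonym ('b, 'c, 'm, 'r) cctx = "('b, 'c, 'm, 'r) citem list"

text \<open>
  Flattened syntax: \<open>UMeta\<close> is a contractive metavariable \<open>H\<^sup>c\<^sup>o\<^sup>n\<close>, \<open>NMeta\<close> a recursive
  metavariable \<open>H\<^sup>r\<^sup>e\<^sup>c\<close>.
\<close>

datatype ('b, 'm, 'r) recu =
    NRec "'b ty list" 'r "nat list"
  | NMeta "'b ty list" 'm "nat list"

datatype ('b, 'c, 'm, 'r) contr =
    UApp "'b ty list" "'c head" "('b, 'm, 'r) recu list"
  | UMeta "'b ty list" 'm "nat list"

datatype ('b, 'c, 'm, 'r) fitem =
    FEqU "('b, 'c, 'm, 'r) contr" "('b, 'c, 'm, 'r) contr"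
  | FEqN "('b, 'm, 'r) recu" "('b, 'm, 'r) recu"
  | FDef 'r "('b, 'c, 'm, 'r) contr"
  | FContra

type_synonym ('b, 'c, 'm, 'r) fctx = "('b, 'c, 'm, 'r) fitem list"

datatype tag = Contractive | Recursive

datatype ('b, 'c, 'm) expansion =
    MApp "'b ty list" "'c head" "('b, 'c, 'm) expansion list"
  | MMeta "'b ty list" tag 'm "nat list"
  | MBot

fun fv_head :: "'c head \<Rightarrow> nat set" where
  "fv_head (Con c) = {}"
| "fv_head (Var i) = {i}"

text \<open>The free variables of a binder block of length \<open>n\<close> whose body has free variables \<open>V\<close>.\<close>

definition unbind :: "nat \<Rightarrow> nat set \<Rightarrow> nat set" where
  "unbind n V = {i. i + n \<in> V}"

fun fv_conc :: "('b, 'c, 'm, 'r) conc \<Rightarrow> nat set" where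
  "fv_conc (CApp xs h Ts) = unbind (length xs) (fv_head h \<union> (\<Union>T \<in> set Ts. fv_conc T))"
| "fv_conc (CMeta xs H ys) = unbind (length xs) (set ys)"
| "fv_conc (CRec xs r ys) = unbind (length xs) (set ys)"

fun rcs_conc :: "('b, 'c, 'm, 'r) conc \<Rightarrow> 'r set" where
  "rcs_conc (CApp xs h Ts) = (\<Union>T \<in> set Ts. rcs_conc T)"
| "rcs_conc (CMeta xs H ys) = {}"
| "rcs_conc (CRec xs r ys) = {r}"

fun rcs_citem :: "('b, 'c, 'm, 'r) citem \<Rightarrow> 'r set" where
  "rcs_citem (CEq T1 T2) = rcs_conc T1 \<union> rcs_conc T2"
| "rcs_citem (CDef r zs h Ts) = insert r (\<Union>T \<in> set Ts. rcs_conc T)"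

definition rcs_cctx :: "('b, 'c, 'm, 'r) cctx \<Rightarrow> 'r set" where
  "rcs_cctx D = (\<Union>e \<in> set D. rcs_citem e)"

fun rcs_recu :: "('b, 'm, 'r) recu \<Rightarrow> 'r set" where
  "rcs_recu (NRec xs r ys) = {r}"
| "rcs_recu (NMeta xs H ys) = {}"

fun rcs_contr :: "('b, 'c, 'm, 'r) contr \<Rightarrow> 'r set" where
  "rcs_contr (UApp xs h Ns) = (\<Union>N \<in> set Ns. rcs_recu N)"
| "rcs_contr (UMeta xs H ys) = {}"

fun rcs_fitem :: "('b, 'c, 'm, 'r) fitem \<Rightarrow> 'r set" where
  "rcs_fitem (FEqU U1 U2) = rcs_contr U1 \<union> rcs_contr U2"
| "rcs_fitem (FEqN N1 N2) = rcs_recu N1 \<union> rcs_recu N2"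
| "rcs_fitem (FDef r U) = insert r (rcs_contr U)"
| "rcs_fitem FContra = {}"

definition rcs_fctx :: "('b, 'c, 'm, 'r) fctx \<Rightarrow> 'r set" where
  "rcs_fctx D = (\<Union>e \<in> set D. rcs_fitem e)"

text \<open>A renaming \<open>p\<close> of indices, pushed under a binder block of length \<open>n\<close>.\<close>

definition lift_ren :: "nat \<Rightarrow> (nat \<Rightarrow> nat) \<Rightarrow> nat \<Rightarrow> nat" where
  "lift_ren n p i = (if i < n then i else p (i - n) + n)"

fun ren_head :: "(nat \<Rightarrow> nat) \<Rightarrow> 'c head \<Rightarrow> 'c head" where
  "ren_head p (Con c) = Con c"
| "ren_head p (Var i) = Var (p i)"

fun ren_conc :: "(nat \<Rightarrow> nat) \<Rightarrow> ('b, 'c, 'm, 'r) conc \<Rightarrow> ('b, 'c, 'm, 'r) conc" where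
  "ren_conc p (CApp xs h Ts) =
     CApp xs (ren_head (lift_ren (length xs) p) h) (map (ren_conc (lift_ren (length xs) p)) Ts)"
| "ren_conc p (CMeta xs H ys) = CMeta xs H (map (lift_ren (length xs) p) ys)"
| "ren_conc p (CRec xs r ys) = CRec xs r (map (lift_ren (length xs) p) ys)"

fun ren_recu :: "(nat \<Rightarrow> nat) \<Rightarrow> ('b, 'm, 'r) recu \<Rightarrow> ('b, 'm, 'r) recu" where
  "ren_recu p (NRec xs r ys) = NRec xs r (map (lift_ren (length xs) p) ys)"
| "ren_recu p (NMeta xs H ys) = NMeta xs H (map (lift_ren (length xs) p) ys)"

fun has_head :: "('b, 'c, 'm, 'r) signature \<Rightarrow> 'b ty list \<Rightarrow> 'c head \<Rightarrow> 'b ty \<Rightarrow> bool" where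
  "has_head sg G (Con c) A \<longleftrightarrow> con_ty sg c = A"
| "has_head sg G (Var i) A \<longleftrightarrow> i < length G \<and> G ! i = A"

definition pattern_args :: "'b ty list \<Rightarrow> nat list \<Rightarrow> 'b ty list \<Rightarrow> bool" where
  "pattern_args G ys As \<longleftrightarrow> distinct ys \<and> list_all2 (\<lambda>y A. y < length G \<and> G ! y = A) ys As"

text \<open>
  Well-typed \<open>\<beta>\<close>-normal \<open>\<eta>\<close>-long terms: the body of each binder block has a base type. The
  arguments of metavariables and recursion constants are not \<open>\<eta>\<close>-expanded.
\<close>

inductive wt_conc :: "('b, 'c, 'm, 'r) signature \<Rightarrow> 'b ty list \<Rightarrow> ('b, 'c, 'm, 'r) conc \<Rightarrow> 'b ty \<Rightarrow> bool"
  for sg where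
  wt_CApp: "has_head sg (xs @ G) h (arrs As (Base b)) \<Longrightarrow> list_all2 (wt_conc sg (xs @ G)) Ts As \<Longrightarrow>
    wt_conc sg G (CApp xs h Ts) (arrs xs (Base b))"
| wt_CMeta: "meta_ty sg H = arrs As (Base b) \<Longrightarrow> pattern_args (xs @ G) ys As \<Longrightarrow>
    wt_conc sg G (CMeta xs H ys) (arrs xs (Base b))"
| wt_CRec: "rec_ty sg r = arrs As (Base b) \<Longrightarrow> pattern_args (xs @ G) ys As \<Longrightarrow>
    wt_conc sg G (CRec xs r ys) (arrs xs (Base b))"

inductive wt_recu :: "('b, 'c, 'm, 'r) signature \<Rightarrow> 'b ty list \<Rightarrow> ('b, 'm, 'r) recu \<Rightarrow> 'b ty \<Rightarrow> bool"
  for sg where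
  wt_NRec: "rec_ty sg r = arrs As (Base b) \<Longrightarrow> pattern_args (xs @ G) ys As \<Longrightarrow>
    wt_recu sg G (NRec xs r ys) (arrs xs (Base b))"
| wt_NMeta: "meta_ty sg H = arrs As (Base b) \<Longrightarrow> pattern_args (xs @ G) ys As \<Longrightarrow>
    wt_recu sg G (NMeta xs H ys) (arrs xs (Base b))"

inductive wt_contr :: "('b, 'c, 'm, 'r) signature \<Rightarrow> 'b ty list \<Rightarrow> ('b, 'c, 'm, 'r) contr \<Rightarrow> 'b ty \<Rightarrow> bool"
  for sg where
  wt_UApp: "has_head sg (xs @ G) h (arrs As (Base b)) \<Longrightarrow> list_all2 (wt_recu sg (xs @ G)) Ns As \<Longrightarrow>
    wt_contr sg G (UApp xs h Ns) (arrs xs (Base b))"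
| wt_UMeta: "meta_ty sg H = arrs As (Base b) \<Longrightarrow> pattern_args (xs @ G) ys As \<Longrightarrow>
    wt_contr sg G (UMeta xs H ys) (arrs xs (Base b))"

definition cdefs :: "('b, 'c, 'm, 'r) cctx \<Rightarrow>
    ('r \<times> 'b ty list \<times> 'c head \<times> ('b, 'c, 'm, 'r) conc list) list" where
  "cdefs D = [(r, zs, h, Ts). CDef r zs h Ts \<leftarrow> D]"

definition fdefs :: "('b, 'c, 'm, 'r) fctx \<Rightarrow> ('r \<times> ('b, 'c, 'm, 'r) contr) list" where
  "fdefs D = [(r, U). FDef r U \<leftarrow> D]"

text \<open>
  \<open>G\<close> types the variables that may occur free in equations. Definitions are closed, that is,
  typed in the empty context; every recursion constant has at most one definition.
\<close>

fun wf_citem :: "('b, 'c, 'm, 'r) signature \<Rightarrow> 'b ty list \<Rightarrow> ('b, 'c, 'm, 'r) citem \<Rightarrow> bool" where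
  "wf_citem sg G (CEq T1 T2) \<longleftrightarrow> (\<exists>A. wt_conc sg G T1 A \<and> wt_conc sg G T2 A)"
| "wf_citem sg G (CDef r zs h Ts) \<longleftrightarrow> wt_conc sg [] (CApp zs h Ts) (rec_ty sg r)"

definition wf_cctx :: "('b, 'c, 'm, 'r) signature \<Rightarrow> 'b ty list \<Rightarrow> ('b, 'c, 'm, 'r) cctx \<Rightarrow> bool" where
  "wf_cctx sg G D \<longleftrightarrow> (\<forall>e \<in> set D. wf_citem sg G e) \<and> distinct (map fst (cdefs D))"

fun wf_fitem :: "('b, 'c, 'm, 'r) signature \<Rightarrow> 'b ty list \<Rightarrow> ('b, 'c, 'm, 'r) fitem \<Rightarrow> bool" where
  "wf_fitem sg G (FEqU U1 U2) \<longleftrightarrow> (\<exists>A. wt_contr sg G U1 A \<and> wt_contr sg G U2 A)"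
| "wf_fitem sg G (FEqN N1 N2) \<longleftrightarrow> (\<exists>A. wt_recu sg G N1 A \<and> wt_recu sg G N2 A)"
| "wf_fitem sg G (FDef r U) \<longleftrightarrow> wt_contr sg [] U (rec_ty sg r)"
| "wf_fitem sg G FContra \<longleftrightarrow> True"

definition wf_fctx :: "('b, 'c, 'm, 'r) signature \<Rightarrow> 'b ty list \<Rightarrow> ('b, 'c, 'm, 'r) fctx \<Rightarrow> bool" where
  "wf_fctx sg G D \<longleftrightarrow> (\<forall>e \<in> set D. wf_fitem sg G e) \<and> distinct (map fst (fdefs D))"

text \<open>
  Two flattened contexts are apart if neither mentions a recursion constant defined in the
  other. The union of contexts that are apart needs no renaming and is list concatenation.
\<close>

definition apart :: "('b, 'c, 'm, 'r) fctx \<Rightarrow> ('b, 'c, 'm, 'r) fctx \<Rightarrow> bool" where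
  "apart D1 D2 \<longleftrightarrow> fst ` set (fdefs D1) \<inter> rcs_fctx D2 = {} \<and> fst ` set (fdefs D2) \<inter> rcs_fctx D1 = {}"

text \<open>
  Expansion is partial: it is \<open>None\<close> exactly if unfolding to depth \<open>k\<close> meets a recursion
  constant without definition. In a closed definition \<open>r =\<^sub>d \<lambda>zs. \<dots>\<close> the variables \<open>zs\<close> are
  the indices \<open>0, \<dots>, length zs - 1\<close>, so \<open>(!) ys\<close> is the simultaneous renaming \<open>[ys/zs]\<close>.
\<close>

function exp_conc :: "('b, 'c, 'm, 'r) cctx \<Rightarrow> nat \<Rightarrow> ('b, 'c, 'm, 'r) conc \<Rightarrow> ('b, 'c, 'm) expansion option" where
  "exp_conc D 0 T = Some MBot"
| "exp_conc D (Suc k) (CApp xs h Ts) = map_option (MApp xs h) (those (map (exp_conc D k) Ts))"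
| "exp_conc D (Suc k) (CMeta xs H ys) = Some (MMeta xs Recursive H ys)"
| "exp_conc D (Suc k) (CRec xs r ys) =
     (case map_of (cdefs D) r of
        None \<Rightarrow> None
      | Some (zs, h, Ts) \<Rightarrow>
          exp_conc D (Suc k) (CApp xs (ren_head ((!) ys) h) (map (ren_conc ((!) ys)) Ts)))"
  by pat_completeness auto
termination
  by (relation "measures [\<lambda>(D, k, T). k, \<lambda>(D, k, T). case T of CRec _ _ _ \<Rightarrow> 1 | _ \<Rightarrow> 0]") auto

text \<open>\<open>subst_def xs ys (\<lambda>zs. U)\<close> is \<open>\<lambda>xs. [ys/zs]U\<close>.\<close>

fun subst_def :: "'b ty list \<Rightarrow> nat list \<Rightarrow> ('b, 'c, 'm, 'r) contr \<Rightarrow> ('b, 'c, 'm, 'r) contr" where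
  "subst_def xs ys (UApp zs h Ns) = UApp xs (ren_head ((!) ys) h) (map (ren_recu ((!) ys)) Ns)"
| "subst_def xs ys (UMeta zs H ws) = UMeta xs H (map ((!) ys) ws)"

function exp_contr :: "('b, 'c, 'm, 'r) fctx \<Rightarrow> nat \<Rightarrow> ('b, 'c, 'm, 'r) contr \<Rightarrow> ('b, 'c, 'm) expansion option"
  and exp_recu :: "('b, 'c, 'm, 'r) fctx \<Rightarrow> nat \<Rightarrow> ('b, 'm, 'r) recu \<Rightarrow> ('b, 'c, 'm) expansion option" where
  "exp_contr D 0 U = Some MBot"
| "exp_contr D (Suc k) (UApp xs h Ns) = map_option (MApp xs h) (those (map (exp_recu D k) Ns))"
| "exp_contr D (Suc k) (UMeta xs H ys) = Some (MMeta xs Contractive H ys)"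
| "exp_recu D 0 N = Some MBot"
| "exp_recu D (Suc k) (NMeta xs H ys) = Some (MMeta xs Recursive H ys)"
| "exp_recu D (Suc k) (NRec xs r ys) =
     (case map_of (fdefs D) r of
        None \<Rightarrow> None
      | Some U \<Rightarrow> exp_contr D (Suc k) (subst_def xs ys U))"
  by pat_completeness auto
termination
  by (relation "measures
    [\<lambda>p. case p of Inl (D, k, U) \<Rightarrow> k | Inr (D, k, N) \<Rightarrow> k, \<lambda>p. case p of Inl _ \<Rightarrow> 0 | Inr _ \<Rightarrow> 1]") auto

text \<open>Equality of partial expressions: both sides are defined and agree.\<close>

definition defined_eq :: "'a option \<Rightarrow> 'a option \<Rightarrow> bool" (infix "\<simeq>" 50) where
  "a \<simeq> b \<longleftrightarrow> (\<exists>M. a = Some M \<and> b = Some M)"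

text \<open>The position of \<open>i\<close> in \<open>zs\<close>; abstracting the variables \<open>zs\<close> renames by \<open>position zs\<close>.\<close>

definition position :: "nat list \<Rightarrow> nat \<Rightarrow> nat" where
  "position zs i = length (takeWhile (\<lambda>z. z \<noteq> i) zs)"

text \<open>
  \<open>F\<close> is a set of recursion constants that fresh recursion constants have to avoid, and \<open>G\<close>
  types the free variables of the translated term. In \<open>trec_App\<close> the term \<open>h Ts\<close> lives in
  \<open>xs @ G\<close> and \<open>zs\<close> enumerates its free variables, in any order; the fresh constant has the
  type of \<open>\<lambda>zs. h Ts\<close>. In \<open>tcon_App\<close> the condition \<open>apart\<close> says that the fresh constants of the
  subderivations are chosen apart.
\<close>

inductive
  trans_con :: "('b, 'c, 'm, 'r) signature \<Rightarrow> 'r set \<Rightarrow> 'b ty list \<Rightarrow> ('b, 'c, 'm, 'r) conc \<Rightarrow>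
    ('b, 'c, 'm, 'r) contr \<Rightarrow> ('b, 'c, 'm, 'r) fctx \<Rightarrow> bool" and
  trans_rec :: "('b, 'c, 'm, 'r) signature \<Rightarrow> 'r set \<Rightarrow> 'b ty list \<Rightarrow> ('b, 'c, 'm, 'r) conc \<Rightarrow>
    ('b, 'm, 'r) recu \<Rightarrow> ('b, 'c, 'm, 'r) fctx \<Rightarrow> bool"
  for sg F where
  trec_Meta: "trans_rec sg F G (CMeta xs H ys) (NMeta xs H ys) []"
| trec_Rec: "trans_rec sg F G (CRec xs r ys) (NRec xs r ys) []"
| trec_App: "trans_con sg F (xs @ G) (CApp [] h Ts) (UApp [] h' Ns) D \<Longrightarrow>
    distinct zs \<Longrightarrow> set zs = fv_conc (CApp [] h Ts) \<Longrightarrow>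
    wt_conc sg (xs @ G) (CApp [] h Ts) (Base b) \<Longrightarrow>
    rec_ty sg r = arrs (map ((!) (xs @ G)) zs) (Base b) \<Longrightarrow>
    r \<notin> F \<union> rcs_conc (CApp [] h Ts) \<union> rcs_fctx D \<Longrightarrow>
    trans_rec sg F G (CApp xs h Ts) (NRec xs r zs)
      (D @ [FDef r (UApp (map ((!) (xs @ G)) zs)
                      (ren_head (position zs) h') (map (ren_recu (position zs)) Ns))])"
| tcon_App: "length Ns = length Ts \<Longrightarrow> length Ds = length Ts \<Longrightarrow>
    (\<forall>i < length Ts. trans_rec sg F (xs @ G) (Ts ! i) (Ns ! i) (Ds ! i)) \<Longrightarrow>
    (\<forall>i < length Ts. \<forall>j < length Ts. i \<noteq> j \<longrightarrow> apart (Ds ! i) (Ds ! j)) \<Longrightarrow>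
    trans_con sg F G (CApp xs h Ts) (UApp xs h Ns) (concat Ds)"

end

(*
  The translation only names subterms by fresh recursion constants, and expansion unfolds those
  names again: abstracting the free variables zs of a subterm renames by position zs, unfolding the
  definition renames back by (!) zs, and these cancel. The induction on the translation derivation
  passes from depth k + 1 to depth k below a head, where the hypothesis on the recursion constants
  is available because the expansion to depth k is a truncation of the one to depth k + 1. Adding
  the definitions of the other, apart, subderivations changes no expansion that is already defined.
*)
theory Submission
  imports Defs
begin

section \<open>Partial expansions: truncation and monotonicity\<close>

lemma those_eq_Some_iff: "those xs = Some ys \<longleftrightarrow> xs = map Some ys"
  by (induction xs arbitrary: ys) (auto split: option.splits simp: Cons_eq_map_conv)

lemma those_map_eq_Some_iff:
  "those (map f xs) = Some ys \<longleftrightarrow> list_all2 (\<lambda>x y. f x = Some y) xs ys"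
  by (auto simp: those_eq_Some_iff list_all2_conv_all_nth list_eq_iff_nth_eq)

text \<open>No context occurs here, so one and the same cut applies to expansions from concrete and
  from flattened contexts; this is what carries an equality down to the smaller depth.\<close>

fun trunc :: "nat \<Rightarrow> ('b, 'c, 'm) expansion \<Rightarrow> ('b, 'c, 'm) expansion" where
  "trunc 0 M = MBot"
| "trunc (Suc k) (MApp xs h Ms) = MApp xs h (map (trunc k) Ms)"
| "trunc (Suc k) (MMeta xs t H ys) = MMeta xs t H ys"
| "trunc (Suc k) MBot = MBot"

lemma exp_conc_trunc:
  "exp_conc D (Suc k) T = Some M \<Longrightarrow> exp_conc D k T = Some (trunc k M)"
proof (induction D k T arbitrary: M rule: exp_conc.induct)
  case (2 D k xs h Ts)
  then show ?case
    by (fastforce simp: those_map_eq_Some_iff list_all2_conv_all_nth)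
next
  case (4 D k xs r ys)
  then show ?case
    \<comment> \<open>The unfolded \<open>CApp\<close> stays intact, because the induction
      hypothesis speaks of it in this form.\<close>
    by (auto split: option.splits simp del: exp_conc.simps(2))
qed auto

lemma exp_contr_trunc:
    "exp_contr D (Suc k) U = Some M \<Longrightarrow> exp_contr D k U = Some (trunc k M)"
  and exp_recu_trunc:
    "exp_recu D (Suc k) N = Some M \<Longrightarrow> exp_recu D k N = Some (trunc k M)"
proof (induction D k U and D k N arbitrary: M and M rule: exp_contr_exp_recu.induct)
  case (2 D k xs h Ns)
  then show ?case
    by (fastforce simp: those_map_eq_Some_iff list_all2_conv_all_nth)
next
  case (6 D k xs r ys)
  then show ?case
    by (auto split: option.splits)
qed auto

lemma defined_eq_exp_pred:
  "exp_conc Dc (Suc k) T \<simeq> exp_recu D (Suc k) N \<Longrightarrow> exp_conc Dc k T \<simeq> exp_recu D k N"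
  unfolding defined_eq_def using exp_conc_trunc exp_recu_trunc by metis

text \<open>A defined expansion only looks up constants that have a definition, and the larger
  partial map answers each such lookup in the same way.\<close>

lemma exp_contr_mono:
    "exp_contr D k U = Some M \<Longrightarrow> map_of (fdefs D) \<subseteq>\<^sub>m map_of (fdefs D') \<Longrightarrow>
      exp_contr D' k U = Some M"
  and exp_recu_mono:
    "exp_recu D k N = Some M \<Longrightarrow> map_of (fdefs D) \<subseteq>\<^sub>m map_of (fdefs D') \<Longrightarrow>
      exp_recu D' k N = Some M"
proof (induction D k U and D k N arbitrary: M and M rule: exp_contr_exp_recu.induct)
  case (2 D k xs h Ns)
  then show ?case
    by (fastforce simp: those_map_eq_Some_iff list_all2_conv_all_nth)
next
  case (6 D k xs r ys)
  from 6(2) obtain U where U: "map_of (fdefs D) r = Some U"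
    and M: "exp_contr D (Suc k) (subst_def xs ys U) = Some M"
    by (auto split: option.splits)
  have "map_of (fdefs D') r = Some U"
    using U 6(3) by (metis domI map_le_def)
  moreover have "exp_contr D' (Suc k) (subst_def xs ys U) = Some M"
    using 6(1)[OF U M 6(3)] .
  ultimately show ?case by simp
qed auto

lemma defined_eq_exp_contr_mono:
  "a \<simeq> exp_contr D k U \<Longrightarrow> map_of (fdefs D) \<subseteq>\<^sub>m map_of (fdefs D') \<Longrightarrow> a \<simeq> exp_contr D' k U"
  unfolding defined_eq_def using exp_contr_mono by metis

lemma defined_eq_exp_recu_mono:
  "a \<simeq> exp_recu D k N \<Longrightarrow> map_of (fdefs D) \<subseteq>\<^sub>m map_of (fdefs D') \<Longrightarrow> a \<simeq> exp_recu D' k N"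
  unfolding defined_eq_def using exp_recu_mono by metis

section \<open>Lookup of definitions in concatenated contexts\<close>

lemma fdefs_append [simp]: "fdefs (D @ D') = fdefs D @ fdefs D'"
  by (simp add: fdefs_def)

lemma fdefs_FDef [simp]: "fdefs [FDef r U] = [(r, U)]"
  by (simp add: fdefs_def)

lemma fst_fdefs_in_rcs_fctx: "r \<in> fst ` set (fdefs D) \<Longrightarrow> r \<in> rcs_fctx D"
  unfolding fdefs_def rcs_fctx_def by (induction D) (auto split: fitem.splits)

lemma map_of_fdefs_eq_None: "r \<notin> rcs_fctx D \<Longrightarrow> map_of (fdefs D) r = None"
  using fst_fdefs_in_rcs_fctx by (metis map_of_eq_None_iff)

lemma map_le_fdefs_append: "map_of (fdefs D) \<subseteq>\<^sub>m map_of (fdefs (D @ D'))"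
  by (auto simp: map_le_def map_add_def)

text \<open>On a concatenation \<open>map_of\<close> returns the leftmost entry, so the other lists
  must be silent about \<open>r\<close> for the one at \<open>i\<close> to be seen.\<close>

lemma map_of_fdefs_concat:
  assumes "i < length Ds"
    and "\<And>j. j < length Ds \<Longrightarrow> j \<noteq> i \<Longrightarrow> map_of (fdefs (Ds ! j)) r = None"
  shows "map_of (fdefs (concat Ds)) r = map_of (fdefs (Ds ! i)) r"
  using assms
proof (induction Ds arbitrary: i)
  case Nil
  then show ?case by simp
next
  case (Cons D Ds)
  show ?case
  proof (cases i)
    case 0
    have "map_of (fdefs E) r = None" if "E \<in> set Ds" for E
      using that Cons.prems(2)[of "Suc _"] 0 by (auto simp: in_set_conv_nth)
    then have "map_of (fdefs (concat Ds)) r = None"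
      by (induction Ds) (auto simp: fdefs_def map_add_def)
    then show ?thesis using 0 by (simp add: map_add_def split: option.splits)
  next
    case (Suc j)
    have "map_of (fdefs (concat Ds)) r = map_of (fdefs (Ds ! j)) r"
      using Cons.IH[of j] Cons.prems(1) Cons.prems(2)[of "Suc _"] Suc by auto
    moreover have "map_of (fdefs D) r = None"
      using Cons.prems(2)[of 0] Suc by simp
    ultimately show ?thesis using Suc by (simp add: map_add_def split: option.splits)
  qed
qed

text \<open>The prefix \<open>D\<close> shadows both sides alike. A constant defined in
  \<open>Ds ! i\<close> does not even occur in another \<open>Ds ! j\<close>, by apartness.\<close>

lemma map_le_fdefs_concat:
  assumes i: "i < length Ds"
    and apart: "\<forall>i < length Ds. \<forall>j < length Ds. i \<noteq> j \<longrightarrow> apart (Ds ! i) (Ds ! j)"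
  shows "map_of (fdefs (D @ Ds ! i)) \<subseteq>\<^sub>m map_of (fdefs (D @ concat Ds))"
proof -
  have "map_of (fdefs (concat Ds)) r = map_of (fdefs (Ds ! i)) r"
    if r: "r \<in> dom (map_of (fdefs (Ds ! i)))" for r
  proof (rule map_of_fdefs_concat[OF i])
    fix j assume j: "j < length Ds" "j \<noteq> i"
    from r have "r \<in> fst ` set (fdefs (Ds ! i))"
      by (simp add: dom_map_of_conv_image_fst)
    with i j apart have "r \<notin> rcs_fctx (Ds ! j)"
      unfolding apart_def by blast
    then show "map_of (fdefs (Ds ! j)) r = None"
      by (rule map_of_fdefs_eq_None)
  qed
  then show ?thesis
    by (auto simp: map_le_def map_add_def dom_def split: option.splits)
qed

section \<open>Free variables and cancelling renamings\<close>

fun fv_recu :: "('b, 'm, 'r) recu \<Rightarrow> nat set" where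
  "fv_recu (NRec xs r ys) = unbind (length xs) (set ys)"
| "fv_recu (NMeta xs H ys) = unbind (length xs) (set ys)"

fun fv_contr :: "('b, 'c, 'm, 'r) contr \<Rightarrow> nat set" where
  "fv_contr (UApp xs h Ns) = unbind (length xs) (fv_head h \<union> (\<Union>N \<in> set Ns. fv_recu N))"
| "fv_contr (UMeta xs H ys) = unbind (length xs) (set ys)"

lemma unbind_0 [simp]: "unbind 0 V = V"
  by (simp add: unbind_def)

lemma unbind_mono: "V \<subseteq> W \<Longrightarrow> unbind n V \<subseteq> unbind n W"
  by (auto simp: unbind_def)

text \<open>In the translation \<open>zs\<close> enumerates the free variables of the concrete body,
  but the renamings have to cancel on those of the flattened one.\<close>

lemma fv_trans:
  "trans_con sg F G T U D \<Longrightarrow> fv_contr U \<subseteq> fv_conc T"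
  "trans_rec sg F G T N D \<Longrightarrow> fv_recu N \<subseteq> fv_conc T"
proof (induction rule: trans_con_trans_rec.inducts)
  case (tcon_App Ns Ts Ds xs G h)
  have "(\<Union>N \<in> set Ns. fv_recu N) \<subseteq> (\<Union>T \<in> set Ts. fv_conc T)"
  proof (rule UN_least)
    fix N
    assume "N \<in> set Ns"
    then obtain i where i: "i < length Ts" "N = Ns ! i"
      using tcon_App.hyps(1) by (metis in_set_conv_nth)
    then have "fv_recu N \<subseteq> fv_conc (Ts ! i)"
      using tcon_App.IH by blast
    also have "\<dots> \<subseteq> (\<Union>T \<in> set Ts. fv_conc T)"
      using i(1) by (intro UN_upper) simp
    finally show "fv_recu N \<subseteq> (\<Union>T \<in> set Ts. fv_conc T)" .
  qed
  then show ?case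
    by (simp, intro unbind_mono) blast
qed auto

text \<open>Both lifted renamings fix the bound indices, so only the indices free outside the block
  need the assumption.\<close>

lemma lift_ren_cancel:
  assumes "\<And>i. i \<in> unbind n (set ys) \<Longrightarrow> q (p i) = i"
  shows "map (lift_ren n q) (map (lift_ren n p) ys) = ys"
  using assms by (auto simp: lift_ren_def unbind_def intro!: map_idI)

lemma ren_recu_cancel:
  assumes "\<And>i. i \<in> fv_recu N \<Longrightarrow> q (p i) = i"
  shows "ren_recu q (ren_recu p N) = N"
  using assms lift_ren_cancel[of _ _ q p] by (cases N) auto

lemma ren_head_cancel:
  assumes "\<And>i. i \<in> fv_head h \<Longrightarrow> q (p i) = i"
  shows "ren_head q (ren_head p h) = h"
  using assms by (cases h) auto

text \<open>Off \<open>zs\<close> the position is \<open>length zs\<close>, hence the restriction to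
  members.\<close>

lemma nth_position: "i \<in> set zs \<Longrightarrow> zs ! position zs i = i"
  unfolding position_def
  by (induction zs) auto

section \<open>Comparison of expansions along a translation derivation\<close>

definition agree :: "('b, 'c, 'm, 'r) signature \<Rightarrow> ('b, 'c, 'm, 'r) cctx \<Rightarrow> ('b, 'c, 'm, 'r) fctx \<Rightarrow>
    nat \<Rightarrow> 'r set \<Rightarrow> bool" where
  "agree sg Dc D k R \<longleftrightarrow>
     (\<forall>s \<in> R. \<forall>G xs ys B. wt_conc sg G (CRec xs s ys) B \<longrightarrow>
        exp_conc Dc k (CRec xs s ys) \<simeq> exp_recu D k (NRec xs s ys))"

text \<open>Below a head the induction passes to a subterm and to a smaller depth, so
  \<open>agree\<close> can be weakened in the set and, by the next lemma, in the depth.\<close>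

lemma agree_mono: "agree sg Dc D k R \<Longrightarrow> R' \<subseteq> R \<Longrightarrow> agree sg Dc D k R'"
  unfolding agree_def by blast

lemma agree_pred: "agree sg Dc D (Suc k) R \<Longrightarrow> agree sg Dc D k R"
  unfolding agree_def using defined_eq_exp_pred by blast

text \<open>The right-hand side does not mention \<open>xs\<close>, so an equality proved for the
  empty binder transfers to any other one.\<close>

lemma exp_App_defined_eq_iff:
  "exp_conc Dc (Suc k) (CApp xs h Ts) \<simeq> exp_contr D (Suc k) (UApp xs h' Ns) \<longleftrightarrow>
     h = h' \<and> list_all2 (\<lambda>T N. exp_conc Dc k T \<simeq> exp_recu D k N) Ts Ns"
  (is "?l \<longleftrightarrow> ?r")
proof
  assume ?l
  then show ?r
    by (auto simp: defined_eq_def those_map_eq_Some_iff list_all2_conv_all_nth)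
next
  assume r: ?r
  then have "\<forall>i < length Ts. \<exists>M. exp_conc Dc k (Ts ! i) = Some M \<and> exp_recu D k (Ns ! i) = Some M"
    by (auto simp: defined_eq_def list_all2_conv_all_nth)
  \<comment> \<open>\<open>M\<close> chooses one common expansion per argument position, which makes
    both argument lists expand to the same list.\<close>
  then obtain M where "\<forall>i < length Ts. exp_conc Dc k (Ts ! i) = Some (M i) \<and>
      exp_recu D k (Ns ! i) = Some (M i)"
    by metis
  then have "those (map (exp_conc Dc k) Ts) = Some (map M [0..<length Ts])"
    "those (map (exp_recu D k) Ns) = Some (map M [0..<length Ts])"
    using r by (auto simp: those_map_eq_Some_iff list_all2_conv_all_nth)
  then show ?l using r by (simp add: defined_eq_def)
qed

text \<open>Naming a subterm costs no depth, while passing below a head costs one; hence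
  \<open>k\<close> is generalised.\<close>

lemma exp_trans:
  assumes "rcs_fctx D1 \<subseteq> F"
  shows "trans_con sg F G T U D2 \<Longrightarrow> wt_conc sg G T A \<Longrightarrow> agree sg Dc D1 k (rcs_conc T) \<Longrightarrow>
      exp_conc Dc k T \<simeq> exp_contr (D1 @ D2) k U"
    and "trans_rec sg F G T N D2 \<Longrightarrow> wt_conc sg G T A \<Longrightarrow> agree sg Dc D1 k (rcs_conc T) \<Longrightarrow>
      exp_conc Dc k T \<simeq> exp_recu (D1 @ D2) k N"
proof (induction arbitrary: A k and A k rule: trans_con_trans_rec.inducts)
  case (trec_Meta G xs H ys)
  show ?case by (cases k) (auto simp: defined_eq_def)
next
  case (trec_Rec G xs r ys)
  then show ?case by (auto simp: agree_def)
next
  case (trec_App xs G h Ts h' Ns D zs b r)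
  show ?case
  proof (cases k)
    case 0
    then show ?thesis by (simp add: defined_eq_def)
  next
    case (Suc l)
    let ?U = "UApp (map ((!) (xs @ G)) zs) (ren_head (position zs) h')
      (map (ren_recu (position zs)) Ns)"
    let ?D = "D1 @ D @ [FDef r ?U]"
    \<comment> \<open>\<open>A\<close> types the term with its binder \<open>xs\<close>; the type of
      the body without it comes from the translation rule.\<close>
    have body: "exp_conc Dc (Suc l) (CApp [] h Ts) \<simeq> exp_contr (D1 @ D) (Suc l) (UApp [] h' Ns)"
      by (rule trec_App.IH(2)[OF trec_App.IH(3)]) (use trec_App.prems(2) Suc in simp)
    have "map_of (fdefs (D1 @ D)) \<subseteq>\<^sub>m map_of (fdefs ?D)"
      by (metis append_assoc map_le_fdefs_append)
    with body have "exp_conc Dc (Suc l) (CApp [] h Ts) \<simeq> exp_contr ?D (Suc l) (UApp [] h' Ns)"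
      by (rule defined_eq_exp_contr_mono)
    then have eq: "exp_conc Dc (Suc l) (CApp xs h Ts) \<simeq> exp_contr ?D (Suc l) (UApp xs h' Ns)"
      unfolding exp_App_defined_eq_iff .
    have "fv_head h' \<union> (\<Union>N \<in> set Ns. fv_recu N) \<subseteq> set zs"
      using fv_trans(1)[OF trec_App.IH(1)] trec_App.hyps(2) by simp
    then have pos: "zs ! position zs i = i" if "i \<in> fv_head h' \<union> (\<Union>N \<in> set Ns. fv_recu N)" for i
      using that nth_position by blast
    have "ren_head ((!) zs) (ren_head (position zs) h') = h'"
      by (rule ren_head_cancel, rule pos) simp
    moreover have "ren_recu ((!) zs) (ren_recu (position zs) N) = N" if "N \<in> set Ns" for N
      by (rule ren_recu_cancel, rule pos) (use that in blast)
    ultimately have "subst_def xs zs ?U = UApp xs h' Ns"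
      by (simp add: map_idI)
    moreover have "map_of (fdefs ?D) r = Some ?U"
    proof -
      \<comment> \<open>The new definition stands last, where lookup arrives only if
        \<open>D1\<close> and \<open>D\<close> do not define \<open>r\<close>; freshness ensures
        this.\<close>
      have "r \<notin> rcs_fctx D1" "r \<notin> rcs_fctx D"
        using trec_App.IH(5) assms by auto
      then have "map_of (fdefs D1) r = None" "map_of (fdefs D) r = None"
        by (simp_all add: map_of_fdefs_eq_None)
      then show ?thesis by (simp add: map_add_def)
    qed
    ultimately have "exp_recu ?D (Suc l) (NRec xs r zs) = exp_contr ?D (Suc l) (UApp xs h' Ns)"
      by simp
    with eq Suc show ?thesis by simp
  qed
next
  case (tcon_App Ns Ts Ds xs G h)
  show ?case
  proof (cases k)
    case 0
    then show ?thesis by (simp add: defined_eq_def)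
  next
    case (Suc l)
    from tcon_App.prems(1) obtain As where "list_all2 (wt_conc sg (xs @ G)) Ts As"
      by cases auto
    then have wt: "wt_conc sg (xs @ G) (Ts ! i) (As ! i)" if "i < length Ts" for i
      using that by (simp add: list_all2_conv_all_nth)
    have "exp_conc Dc l (Ts ! i) \<simeq> exp_recu (D1 @ concat Ds) l (Ns ! i)" if i: "i < length Ts" for i
    proof (rule defined_eq_exp_recu_mono)
      have "rcs_conc (Ts ! i) \<subseteq> rcs_conc (CApp xs h Ts)"
        using i by (auto intro: nth_mem)
      then have "agree sg Dc D1 l (rcs_conc (Ts ! i))"
        using tcon_App.prems(2) unfolding Suc by (blast intro: agree_mono agree_pred)
      then show "exp_conc Dc l (Ts ! i) \<simeq> exp_recu (D1 @ Ds ! i) l (Ns ! i)"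
        using tcon_App.IH wt[OF i] i by blast
      show "map_of (fdefs (D1 @ Ds ! i)) \<subseteq>\<^sub>m map_of (fdefs (D1 @ concat Ds))"
        using map_le_fdefs_concat tcon_App.hyps i by metis
    qed
    then show ?thesis
      unfolding Suc exp_App_defined_eq_iff
      using tcon_App.hyps(1) by (simp add: list_all2_conv_all_nth)
  qed
qed

theorem theorem3p1:
  fixes sg :: "('b, 'c, 'm, 'r) signature"
    and G :: "'b ty list"
    and Dc :: "('b, 'c, 'm, 'r) cctx"
    and T :: "('b, 'c, 'm, 'r) conc"
    and A :: "'b ty"
    and D1 :: "('b, 'c, 'm, 'r) fctx"
    and k :: nat
    and F :: "'r set"
  assumes "wf_cctx sg G Dc"
    and "wt_conc sg G T A"
    and "wf_fctx sg G D1"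
    and "\<And>s G' xs ys B. s \<in> rcs_conc T \<Longrightarrow> wt_conc sg G' (CRec xs s ys) B \<Longrightarrow>
           exp_conc Dc k (CRec xs s ys) \<simeq> exp_recu D1 k (NRec xs s ys)"
    and "F = rcs_cctx Dc \<union> rcs_fctx D1 \<union> rcs_conc T"
  shows "(\<forall>U D2. trans_con sg F G T U D2 \<longrightarrow> exp_conc Dc k T \<simeq> exp_contr (D1 @ D2) k U) \<and>
         (\<forall>N D2. trans_rec sg F G T N D2 \<longrightarrow> exp_conc Dc k T \<simeq> exp_recu (D1 @ D2) k N)"
proof -
  have F: "rcs_fctx D1 \<subseteq> F"
    using assms(5) by auto
  have "agree sg Dc D1 k (rcs_conc T)"
    using assms(4) by (simp add: agree_def)
  then show ?thesis
    using exp_trans[OF F] assms(2) by blast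
qed

end
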